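(* In the model described in the context, if $k\le 2g$ then no algorithm solves the $g$-partial gathering problem in dynamic (1-interval connected) rings.
   Context: Model. A dynamic bidirectional ring has anonymous nodes $v_0,\dots,v_{n-1}$ and links $e_i=\{v_i,v_{i+1 \bmod n}\}$; in each round an adversary may make at most one link missing (1-interval connectivity). Each node has a whiteboard that agents located there can read and write. There are $k\le n$ agents, which are deterministic finite automata with distinct IDs, knowledge of $n$ and $k$, and chirality (a common notion of forward $v_i\to v_{i+1}$ and backward $v_i\to v_{i-1}$). Agents cannot directly detect other agents at their node. Initially agents occupy pairwise distinct nodes, and a node's whiteboard is initially in one of two special states according to whether an agent starts there. Execution is fully synchronous: in each round every agent atomically reads the whiteboard, changes state, writes the whiteboard, and either stays or tries to move to a neighbouring node; if the link it tries to traverse is missing in that round it is blocked and stays. An agent terminates by entering a final state, after which it never acts. Problem. For a given positive integer $g<k$, an algorithm solves the $g$-partial gathering problem if every execution (against every adversary) is finite (all agents terminate) and in the final configuration every node hosting at least one agent hosts at least $g$ agents.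
   Formalization: The case g = 1 (hence k = 2) is excluded, because there the claim is false: 1-partial gathering is solved by every agent terminating immediately; all cases with g ≥ 2 are covered. *)

theory Defs
  imports Main
begin

datatype move = Stay | Forward | Backward

text \<open>
  An algorithm assigns to every ID (a natural number) a deterministic automaton; all automata share
  the whiteboard alphabet \<^typ>\<open>'w\<close>. An algorithm is considered for one fixed triple $n$, $k$, $g$,
  so the automata may depend on these numbers: this is the agents' knowledge of $n$ and $k$.
  An agent's only input is the content of the whiteboard at its current node.
\<close>

record ('s, 'w) algorithm =
  states :: "nat \<Rightarrow> 's set"
  init_state :: "nat \<Rightarrow> 's"
  final_states :: "nat \<Rightarrow> 's set"
  delta :: "nat \<Rightarrow> 's \<Rightarrow> 'w \<Rightarrow> 's \<times> 'w \<times> move"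
  board_empty :: 'w  \<comment> \<open>initial whiteboard of a node where no agent starts\<close>
  board_home :: 'w   \<comment> \<open>initial whiteboard of a node where an agent starts\<close>

definition wf_algorithm :: "('s, 'w) algorithm \<Rightarrow> bool" where
  "wf_algorithm A \<longleftrightarrow>
     (\<forall>i. finite (states A i) \<and> init_state A i \<in> states A i \<and> final_states A i \<subseteq> states A i \<and>
        (\<forall>s\<in>states A i. \<forall>w. fst (delta A i s w) \<in> states A i)) \<and>
     board_empty A \<noteq> board_home A"

text \<open>
  Nodes are $0, \dots, n-1$, and link $i$ joins the nodes $i$ and $(i+1) \bmod n$.
  Agents are named $0, \dots, k-1$; these names are not visible to the algorithm, which is only
  given the ID \<open>ident a\<close> of agent \<open>a\<close>.
\<close>

fun target :: "nat \<Rightarrow> nat \<Rightarrow> move \<Rightarrow> nat" where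
  "target n v Stay = v"
| "target n v Forward = (v + 1) mod n"
| "target n v Backward = (v + n - 1) mod n"

fun links_used :: "nat \<Rightarrow> nat \<Rightarrow> move \<Rightarrow> nat set" where
  "links_used n v Stay = {}"
| "links_used n v Forward = {v}"
| "links_used n v Backward = {(v + n - 1) mod n}"

record ('s, 'w) config =
  pos :: "nat \<Rightarrow> nat"
  state :: "nat \<Rightarrow> 's"
  board :: "nat \<Rightarrow> 'w"

definition act ::
  "('s, 'w) algorithm \<Rightarrow> nat \<Rightarrow> (nat \<Rightarrow> nat) \<Rightarrow> nat set \<Rightarrow> nat \<Rightarrow> ('s, 'w) config \<Rightarrow> ('s, 'w) config" where
  "act A n ident missing a c =
     (let i = ident a; v = pos c a in
      if state c a \<in> final_states A i then c
      else case delta A i (state c a) (board c v) of (s, w, m) \<Rightarrow>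
        \<lparr>pos = (pos c)(a := if links_used n v m \<inter> missing = {} then target n v m else v),
         state = (state c)(a := s),
         board = (board c)(v := w)\<rparr>)"

text \<open>
  In a round every agent acts once. Agents at the same node access its whiteboard atomically one
  after another, in the order in which they occur in the list \<open>order t\<close>. Since an agent acts only
  once per round and agents influence each other only through whiteboards, letting each agent move
  immediately after its own action is the same as letting all agents move at the end of the round.
\<close>

primrec run ::
  "('s, 'w) algorithm \<Rightarrow> nat \<Rightarrow> (nat \<Rightarrow> nat) \<Rightarrow> (nat \<Rightarrow> nat set) \<Rightarrow> (nat \<Rightarrow> nat list) \<Rightarrow>
    ('s, 'w) config \<Rightarrow> nat \<Rightarrow> ('s, 'w) config" where
  "run A n ident missing order c 0 = c"
| "run A n ident missing order c (Suc t) =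
     fold (act A n ident (missing t)) (order t) (run A n ident missing order c t)"

definition initial_config ::
  "('s, 'w) algorithm \<Rightarrow> nat \<Rightarrow> (nat \<Rightarrow> nat) \<Rightarrow> (nat \<Rightarrow> nat) \<Rightarrow> ('s, 'w) config" where
  "initial_config A k ident start =
     \<lparr>pos = start,
      state = (\<lambda>a. init_state A (ident a)),
      board = (\<lambda>v. if v \<in> start ` {..<k} then board_home A else board_empty A)\<rparr>"

definition one_interval_connected :: "nat \<Rightarrow> (nat \<Rightarrow> nat set) \<Rightarrow> bool" where
  "one_interval_connected n missing \<longleftrightarrow> (\<forall>t. missing t \<subseteq> {..<n} \<and> card (missing t) \<le> 1)"

definition valid_orders :: "nat \<Rightarrow> (nat \<Rightarrow> nat list) \<Rightarrow> bool" where
  "valid_orders k order \<longleftrightarrow> (\<forall>t. distinct (order t) \<and> set (order t) = {..<k})"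

definition all_terminated ::
  "('s, 'w) algorithm \<Rightarrow> nat \<Rightarrow> (nat \<Rightarrow> nat) \<Rightarrow> ('s, 'w) config \<Rightarrow> bool" where
  "all_terminated A k ident c \<longleftrightarrow> (\<forall>a<k. state c a \<in> final_states A (ident a))"

definition partially_gathered :: "nat \<Rightarrow> nat \<Rightarrow> nat \<Rightarrow> ('s, 'w) config \<Rightarrow> bool" where
  "partially_gathered n k g c \<longleftrightarrow>
     (\<forall>v<n. (\<exists>a<k. pos c a = v) \<longrightarrow> g \<le> card {a. a < k \<and> pos c a = v})"

text \<open>
  As algorithms are deterministic, an execution is determined by the IDs, the starting nodes, the
  missing links and the orders of the atomic actions; quantifying over all sequences of missing
  links covers adaptive adversaries. A configuration in which all agents have terminated never
  changes again, hence is the final one.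
\<close>

definition solves_partial_gathering ::
  "nat \<Rightarrow> nat \<Rightarrow> nat \<Rightarrow> ('s, 'w) algorithm \<Rightarrow> bool" where
  "solves_partial_gathering n k g A \<longleftrightarrow>
     (\<forall>ident start missing order.
        inj_on ident {..<k} \<and> inj_on start {..<k} \<and> start ` {..<k} \<subseteq> {..<n} \<and>
        one_interval_connected n missing \<and> valid_orders k order \<longrightarrow>
        (\<exists>T. let c = run A n ident missing order (initial_config A k ident start) T in
             all_terminated A k ident c \<and> partially_gathered n k g c))"

text \<open>
  For $g = 1$ the problem is trivial: every agent terminates in the first round.
  Hence $g = 1$, $k = 2$ has to be excluded from the impossibility result for $k \le 2g$.
\<close>

lemma one_partial_gathering_solvable:
  "\<exists>A :: (bool, bool) algorithm. wf_algorithm A \<and> solves_partial_gathering n k 1 A"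
proof -
  define A :: "(bool, bool) algorithm" where
    "A = \<lparr>states = (\<lambda>_. UNIV), init_state = (\<lambda>_. False), final_states = (\<lambda>_. {True}),
          delta = (\<lambda>_ _ w. (True, w, Stay)), board_empty = False, board_home = True\<rparr>"
  have ended: "state (fold (act A n ident M) xs c) a \<longleftrightarrow> a \<in> set xs \<or> state c a" for ident M xs c a
    by (induction xs arbitrary: c) (auto simp: act_def A_def Let_def)
  have gathered: "partially_gathered n k 1 c" for c :: "(bool, bool) config"
    unfolding partially_gathered_def by (auto simp: Suc_le_eq card_gt_0_iff)
  have "solves_partial_gathering n k 1 A"
    unfolding solves_partial_gathering_def
  proof (intro allI impI, rule exI[of _ 1], unfold Let_def, rule conjI[OF _ gathered])
    fix ident start :: "nat \<Rightarrow> nat" and missing order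
    assume "inj_on ident {..<k} \<and> inj_on start {..<k} \<and> start ` {..<k} \<subseteq> {..<n} \<and>
      one_interval_connected n missing \<and> valid_orders k order"
    then have "set (order 0) = {..<k}"
      by (simp add: valid_orders_def)
    then show "all_terminated A k ident (run A n ident missing order (initial_config A k ident start) 1)"
      using ended by (simp add: all_terminated_def A_def)
  qed
  moreover have "wf_algorithm A"
    by (simp add: wf_algorithm_def A_def)
  ultimately show ?thesis by blast
qed

end

theory Submission
  imports Defs
begin

text \<open>
  The adversary keeps the configuration from ever being partially gathered, one round at a time.
  What the agents write and where they try to move in a round does not depend on the link that is
  missing in that round. Suppose that the outcome of a round is partially gathered whichever link is
  missing, and also if none is. Comparing the numbers of agents at a node \<open>w\<close> and its two neighbours
  when nothing, the link before \<open>w\<close>, or the link after \<open>w\<close> is missing, and using that at most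
  $k \le 2g$ agents are involved, one finds that \<open>w\<close> already hosted no agent or at least $g$ agents
  before the round. So the configuration was partially gathered before the round as well. The
  initial one is not, since the agents start at distinct nodes and $g \ge 2$.
\<close>

text \<open>Isolates the only place where the missing links enter \<open>act\<close>.\<close>

definition moved :: "nat \<Rightarrow> nat set \<Rightarrow> nat \<Rightarrow> move \<Rightarrow> nat" where
  "moved n M v m = (if links_used n v m \<inter> M = {} then target n v m else v)"

lemma moved_less: "v < n \<Longrightarrow> moved n M v m < n"
  by (cases m) (auto simp: moved_def)

lemma act_final: "state c a \<in> final_states A (ident a) \<Longrightarrow> act A n ident M a c = c"
  by (simp add: act_def)

lemma act_step:
  assumes "state c a \<notin> final_states A (ident a)"
    and "delta A (ident a) (state c a) (board c (pos c a)) = (s, w, m)"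
  shows "act A n ident M a c =
    \<lparr>pos = (pos c)(a := moved n M (pos c a) m), state = (state c)(a := s),
     board = (board c)(pos c a := w)\<rparr>"
  using assms by (simp add: act_def moved_def Let_def)

text \<open>Each agent acts once per round, so it reads the whiteboard of the node where it began
  the round, and nobody perceives whether another agent was blocked. Hence \<open>mv\<close>,
  \<open>s\<close> and \<open>b\<close> can be fixed before \<open>M\<close>.\<close>

lemma round_moves_independent_of_missing:
  assumes "distinct xs"
  shows "\<exists>mv s b. \<forall>M. let c' = fold (act A n ident M) xs c in
    state c' = s \<and> board c' = b \<and> pos c' = (\<lambda>a. moved n M (pos c a) (mv a)) \<and>
    (\<forall>a. a \<notin> set xs \<longrightarrow> mv a = Stay)"
  using assms
proof (induction xs rule: rev_induct)
  case Nil
  then show ?case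
    by (intro exI[of _ "\<lambda>_. Stay"]) (auto simp: moved_def)
next
  case (snoc a xs)
  then obtain mv s b where IH: "\<And>M. state (fold (act A n ident M) xs c) = s"
      "\<And>M. board (fold (act A n ident M) xs c) = b"
      "\<And>M. pos (fold (act A n ident M) xs c) = (\<lambda>a. moved n M (pos c a) (mv a))"
      "\<And>a. a \<notin> set xs \<Longrightarrow> mv a = Stay"
    by (auto simp: Let_def)
  \<comment> \<open>The default \<open>Stay\<close> for agents yet to act ensures that
    \<open>a\<close> is still at \<open>pos c a\<close> when its turn comes.\<close>
  have mv_a: "mv a = Stay"
    using snoc.prems IH(4) by simp
  have pos_a: "moved n M (pos c a) (mv a) = pos c a" for M
    by (simp add: mv_a moved_def)
  show ?case
  proof (cases "s a \<in> final_states A (ident a)")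
    case True
    then show ?thesis
      using IH by (intro exI[of _ mv] exI[of _ s] exI[of _ b]) (auto simp: act_final Let_def)
  next
    case False
    obtain s' w m where step: "delta A (ident a) (s a) (b (pos c a)) = (s', w, m)"
      by (cases "delta A (ident a) (s a) (b (pos c a))")
    have "act A n ident M a (fold (act A n ident M) xs c) =
        \<lparr>pos = (\<lambda>x. moved n M (pos c x) ((mv(a := m)) x)), state = s(a := s'),
         board = b(pos c a := w)\<rparr>" for M
      using act_step[of "fold (act A n ident M) xs c" a A ident s' w m n M] False step pos_a
      by (auto simp: IH(1-3))
    then show ?thesis
      using IH(4)
      by (intro exI[of _ "mv(a := m)"] exI[of _ "s(a := s')"] exI[of _ "b(pos c a := w)"])
        (auto simp: Let_def)
  qed
qed

definition movers :: "nat \<Rightarrow> (nat \<Rightarrow> nat) \<Rightarrow> (nat \<Rightarrow> move) \<Rightarrow> nat \<Rightarrow> move \<Rightarrow> nat" where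
  "movers k p mv v m = card {a. a < k \<and> p a = v \<and> mv a = m}"

text \<open>With counts as sums of indicators, identities between them can be checked agent by
  agent.\<close>

lemma card_less_eq_sum: "card {a. a < k \<and> P a} = (\<Sum>a<k. of_bool (P a))" for k :: nat
  using sum.inter_filter[of "{..<k}" "\<lambda>_. 1 :: nat" P] by (simp add: of_bool_def)

lemma card_before_round:
  "card {a. a < k \<and> p a = v} = movers k p mv v Stay + movers k p mv v Forward + movers k p mv v Backward"
  unfolding movers_def card_less_eq_sum sum.distrib[symmetric]
proof (rule sum.cong)
  fix a
  show "(of_bool (p a = v) :: nat) = of_bool (p a = v \<and> mv a = Stay) +
      of_bool (p a = v \<and> mv a = Forward) + of_bool (p a = v \<and> mv a = Backward)"
    by (cases "mv a") auto
qed simp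

lemma pred_mod: "v < n \<Longrightarrow> (v + n - 1) mod n = (if v = 0 then n - 1 else v - 1)" for v n :: nat
  by (cases v) auto

lemma succ_mod: "v < n \<Longrightarrow> (v + 1) mod n = (if v + 1 = n then 0 else v + 1)" for v n :: nat
  by auto

text \<open>Link \<open>v\<close> carries both the forward moves out of \<open>v\<close> and the
  backward moves into \<open>v\<close>. If present, it trades the former agents for the latter; if
  missing, it keeps the former. The link before \<open>v\<close> is the mirror image.\<close>

lemma card_after_round:
  assumes "2 \<le> n" and "\<And>a. a < k \<Longrightarrow> p a < n" and "v < n"
  shows "card {a. a < k \<and> moved n M (p a) (mv a) = v} =
    movers k p mv v Stay +
    (if v \<in> M then movers k p mv v Forward else movers k p mv ((v + 1) mod n) Backward) +
    (if (v + n - 1) mod n \<in> M then movers k p mv v Backward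
     else movers k p mv ((v + n - 1) mod n) Forward)"
proof -
  have "(of_bool (moved n M (p a) (mv a) = v) :: nat) = of_bool (p a = v \<and> mv a = Stay) +
      (if v \<in> M then of_bool (p a = v \<and> mv a = Forward)
       else of_bool (p a = (v + 1) mod n \<and> mv a = Backward)) +
      (if (v + n - 1) mod n \<in> M then of_bool (p a = v \<and> mv a = Backward)
       else of_bool (p a = (v + n - 1) mod n \<and> mv a = Forward))" if "a < k" for a
    using assms(1,3) assms(2)[OF that]
    by (cases "mv a") (auto simp: moved_def pred_mod succ_mod simp del: One_nat_def)
  then have "(\<Sum>a<k. (of_bool (moved n M (p a) (mv a) = v) :: nat)) =
      (\<Sum>a<k. of_bool (p a = v \<and> mv a = Stay) +
      (if v \<in> M then of_bool (p a = v \<and> mv a = Forward)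
       else of_bool (p a = (v + 1) mod n \<and> mv a = Backward)) +
      (if (v + n - 1) mod n \<in> M then of_bool (p a = v \<and> mv a = Backward)
       else of_bool (p a = (v + n - 1) mod n \<and> mv a = Forward)))"
    by (intro sum.cong) auto
  then show ?thesis
    unfolding movers_def card_less_eq_sum by (simp add: sum.distrib)
qed

lemma card_three_nodes_le:
  assumes "u \<noteq> v" and "u \<noteq> w" and "v \<noteq> w"
  shows "card {a. a < k \<and> q a = u} + card {a. a < k \<and> q a = v} + card {a. a < k \<and> q a = w} \<le> (k::nat)"
proof -
  have "(\<Sum>a<k. of_bool (q a = u) + of_bool (q a = v) + of_bool (q a = w)) \<le> (\<Sum>a<k. 1 :: nat)"
    using assms by (intro sum_mono) auto
  then show ?thesis
    by (simp add: card_less_eq_sum sum.distrib)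
qed

text \<open>
  Here \<open>s\<close>, \<open>f\<close>, \<open>b\<close> count the agents at \<open>w\<close> that stay, try to move forward and try to move
  backward, \<open>f'\<close> and \<open>b'\<close> those trying to enter \<open>w\<close> from behind and from ahead, and \<open>l\<close>, \<open>r\<close> the
  other agents ending up at the two neighbours of \<open>w\<close>.
\<close>

lemma count_before_round_admissible:
  fixes s f b f' b' l r g :: nat
  defines "ok \<equiv> \<lambda>x. x = 0 \<or> g \<le> x"
  assumes "ok (s + f' + b')" and "ok (l + b)" and "ok (r + f)"
    and "ok (s + f' + f)" and "ok (r + b')" and "ok (s + b + b')" and "ok (l + f')"
    and "(l + b) + (s + f' + b') + (r + f) \<le> 2 * g"
  shows "ok (s + f + b)"
  \<comment> \<open>For \<open>g > 0\<close> the total forces one of the three counts without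
    missing link to be 0. If \<open>s + f' + b' = 0\<close>, then \<open>f\<close> and
    \<open>b\<close> are each admissible, hence so is their sum. If \<open>l + b = 0\<close>, then
    \<open>f'\<close> is admissible: for \<open>f' = 0\<close> the sought count is
    \<open>s + f' + f\<close>; otherwise at most \<open>g\<close> agents remain for
    \<open>s + b' + r + f\<close>, and the other hypotheses decide. The case
    \<open>r + f = 0\<close> is symmetric.\<close>
  using assms(2-) unfolding ok_def by (elim disjE) linarith+

lemma partially_gathered_iff:
  "partially_gathered n k g c \<longleftrightarrow>
     (\<forall>v<n. card {a. a < k \<and> pos c a = v} = 0 \<or> g \<le> card {a. a < k \<and> pos c a = v})"
  unfolding partially_gathered_def by auto

lemma adversary_round:
  assumes "3 \<le> n" and "k \<le> 2 * g" and "distinct xs"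
    and "\<And>a. a < k \<Longrightarrow> pos c a < n"
    and "\<not> partially_gathered n k g c"
  shows "\<exists>M. M \<subseteq> {..<n} \<and> card M \<le> 1 \<and>
    \<not> partially_gathered n k g (fold (act A n ident M) xs c)"
proof (rule ccontr)
  assume contr: "\<not> ?thesis"
  obtain mv where mv: "\<And>M. pos (fold (act A n ident M) xs c) = (\<lambda>a. moved n M (pos c a) (mv a))"
    using round_moves_independent_of_missing[OF assms(3), of A n ident c] by (auto simp: Let_def)
  define N where "N M v = card {a. a < k \<and> moved n M (pos c a) (mv a) = v}" for M v
  define S F B where "S = (\<lambda>v. movers k (pos c) mv v Stay)"
    and "F = (\<lambda>v. movers k (pos c) mv v Forward)" and "B = (\<lambda>v. movers k (pos c) mv v Backward)"
  have N: "N M v = S v + (if v \<in> M then F v else B ((v + 1) mod n)) +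
      (if (v + n - 1) mod n \<in> M then B v else F ((v + n - 1) mod n))" if "v < n" for M v
    unfolding N_def S_def F_def B_def using assms(1) by (intro card_after_round assms(4) that) auto
  have ok: "N M v = 0 \<or> g \<le> N M v" if "M \<subseteq> {..<n}" "card M \<le> 1" "v < n" for M v
  proof -
    have "partially_gathered n k g (fold (act A n ident M) xs c)"
      using contr that by blast
    then show ?thesis
      using that(3) unfolding partially_gathered_iff mv N_def by blast
  qed
  have "card {a. a < k \<and> pos c a = w} = 0 \<or> g \<le> card {a. a < k \<and> pos c a = w}" if w: "w < n" for w
  proof -
    \<comment> \<open>Link \<open>u\<close> lies before \<open>w\<close> and link \<open>w\<close>
      after it; \<open>3 \<le> n\<close> makes \<open>u\<close>, \<open>w\<close>, \<open>v\<close>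
      distinct.\<close>
    define u v where "u = (w + n - 1) mod n" and "v = (w + 1) mod n"
    have uv: "u < n" "v < n" "(u + 1) mod n = w" "(v + n - 1) mod n = w"
        "u \<noteq> v" "u \<noteq> w" "v \<noteq> w"
      using w assms(1) unfolding u_def v_def by (auto simp: pred_mod succ_mod simp del: One_nat_def)
    \<comment> \<open>Removing link \<open>u\<close> thus leaves the other link at \<open>u\<close>
      intact, as \<open>N {u} u\<close> below requires.\<close>
    have "(u + n - 1) mod n \<noteq> u"
      using uv(1) assms(1) by (subst pred_mod) auto
    note uv = uv this
    define l r where "l = S u + F ((u + n - 1) mod n)" and "r = S v + B ((v + 1) mod n)"
    \<comment> \<open>Removing one link at \<open>w\<close> leaves the count at the neighbour across
      the other link unchanged, so seven of the nine counts suffice.\<close>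
    have counts: "N {} w = S w + F u + B v" "N {} u = l + B w" "N {} v = r + F w"
        "N {w} w = S w + F u + F w" "N {w} v = r + B v"
        "N {u} w = S w + B w + B v" "N {u} u = l + F u"
      using uv(5-)
      unfolding N[OF w] N[OF uv(1)] N[OF uv(2)] l_def r_def uv(3,4) u_def[symmetric] v_def[symmetric]
      by simp_all
    have "N {} u + N {} w + N {} v \<le> k"
      unfolding N_def by (intro card_three_nodes_le uv uv(7)[symmetric])
    then have total: "N {} u + N {} w + N {} v \<le> 2 * g"
      using assms(2) by simp
    have "S w + F w + B w = 0 \<or> g \<le> S w + F w + B w"
      by (rule count_before_round_admissible[of _ "F u" "B v" g l _ r];
          unfold counts[symmetric]; (rule total | rule ok; use w uv(1,2) in simp))
    then show ?thesis
      unfolding card_before_round[of k "pos c" w mv] S_def F_def B_def .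
  qed
  then show False
    using assms(5) unfolding partially_gathered_iff by blast
qed

lemma adversary_forever:
  fixes A :: "('s, 'w) algorithm"
  assumes "3 \<le> n" and "k \<le> 2 * g" and "\<And>t. distinct (order t)"
    and "\<And>a. a < k \<Longrightarrow> pos c a < n"
    and "\<not> partially_gathered n k g c"
  shows "\<exists>missing. one_interval_connected n missing \<and>
    (\<forall>t. \<not> partially_gathered n k g (run A n ident missing order c t))"
proof -
  \<comment> \<open>The bound on positions is carried along because \<open>adversary_round\<close>
    requires it in every round.\<close>
  define inv :: "('s, 'w) config \<Rightarrow> bool" where
    "inv d \<longleftrightarrow> (\<forall>a<k. pos d a < n) \<and> \<not> partially_gathered n k g d" for d
  define legal where "legal M \<longleftrightarrow> M \<subseteq> {..<n} \<and> card M \<le> 1" for M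
  have step: "\<exists>M. legal M \<and> inv (fold (act A n ident M) (order t) d)" if "inv d" for d t
  proof -
    obtain M where M: "legal M" "\<not> partially_gathered n k g (fold (act A n ident M) (order t) d)"
      using adversary_round[OF assms(1,2) assms(3)[of t], where c = d and A = A and ident = ident]
        \<open>inv d\<close>
      unfolding inv_def legal_def by blast
    obtain mv where "pos (fold (act A n ident M) (order t) d) = (\<lambda>a. moved n M (pos d a) (mv a))"
      using round_moves_independent_of_missing[OF assms(3)[of t], of A n ident d]
      by (auto simp: Let_def)
    then show ?thesis
      using M \<open>inv d\<close> by (intro exI[of _ M]) (auto simp: inv_def moved_less)
  qed
  obtain C where C0: "C 0 = c" and C: "\<And>t. inv (C t)"
    and C_Suc: "\<And>t. \<exists>M. legal M \<and> C (Suc t) = fold (act A n ident M) (order t) (C t)"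
  proof -
    \<comment> \<open>The choice runs over configurations, anchored at \<open>c\<close> by the
      clause for \<open>t = 0\<close>; the missing links are extracted afterwards.\<close>
    have "\<exists>C. \<forall>t. (inv (C t) \<and> (t = 0 \<longrightarrow> C t = c)) \<and>
        (\<exists>M. legal M \<and> C (Suc t) = fold (act A n ident M) (order t) (C t))"
    proof (rule dependent_nat_choice)
      show "\<exists>d. inv d \<and> (0 = (0::nat) \<longrightarrow> d = c)"
        using assms(4,5) by (auto simp: inv_def)
    next
      fix d :: "('s, 'w) config" and t :: nat
      assume "inv d \<and> (t = 0 \<longrightarrow> d = c)"
      then show "\<exists>e. (inv e \<and> (Suc t = 0 \<longrightarrow> e = c)) \<and>
          (\<exists>M. legal M \<and> e = fold (act A n ident M) (order t) d)"
        using step[of d t] by auto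
    qed
    then show ?thesis
      using that by blast
  qed
  obtain missing where missing: "\<And>t. legal (missing t)"
    "\<And>t. C (Suc t) = fold (act A n ident (missing t)) (order t) (C t)"
    using C_Suc by metis
  have "run A n ident missing order c t = C t" for t
    by (induction t) (simp_all add: C0 missing(2))
  then show ?thesis
    using missing(1) C unfolding one_interval_connected_def legal_def inv_def
    by (intro exI[of _ missing]) auto
qed

theorem theorem3:
  fixes n k g :: nat
  assumes "g > 0" and "g < k" and "k \<le> n"
    and "k \<le> 2 * g"
    and "g \<noteq> 1"
  shows "\<not> (\<exists>A :: ('s, 'w) algorithm. wf_algorithm A \<and> solves_partial_gathering n k g A)"
proof
  assume "\<exists>A :: ('s, 'w) algorithm. wf_algorithm A \<and> solves_partial_gathering n k g A"
  then obtain A :: "('s, 'w) algorithm" where A: "solves_partial_gathering n k g A"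
    by blast
  define order where "order = (\<lambda>t::nat. [0..<k])"
  define c where "c = initial_config A k id id"
  \<comment> \<open>Agent 0 is alone at node 0, too few once \<open>g \<ge> 2\<close>.\<close>
  have "{a. a < k \<and> pos c a = 0} = {0}"
    using assms by (auto simp: c_def initial_config_def)
  then have "card {a. a < k \<and> pos c a = 0} = 1"
    by simp
  moreover have "0 < n" and "2 \<le> g"
    using assms by linarith+
  ultimately have not_gathered: "\<not> partially_gathered n k g c"
    unfolding partially_gathered_iff by fastforce
  \<comment> \<open>Here \<open>3 \<le> n\<close> comes from
    \<open>2 \<le> g < k \<le> n\<close>.\<close>
  obtain missing where missing: "one_interval_connected n missing"
    "\<And>t. \<not> partially_gathered n k g (run A n id missing order c t)"
    using adversary_forever[of n k g order c A id] assms not_gathered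
    by (auto simp: order_def c_def initial_config_def)
  have "valid_orders k order"
    by (auto simp: valid_orders_def order_def)
  then obtain T where "partially_gathered n k g (run A n id missing order c T)"
    using A missing(1) assms(3) unfolding solves_partial_gathering_def Let_def c_def
    by (metis id_apply image_id inj_on_id lessThan_subset_iff)
  then show False
    using missing(2) by blast
qed

end
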